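(* Let $K$ be a virtual link with $c$ components, given by an oriented virtual link diagram $D$. Then $K$ has exactly $2^c$ alternately coloured smoothings on an abstract link diagram with cross cuts (as defined in the context). These alternately coloured smoothings are in bijective correspondence with the $2^c$ possible orientations of the $c$ components of $K$.
   Context: A virtual link diagram is a generic immersion of circles in the plane each of whose double points is either a classical crossing (with over/under information) or a virtual crossing. A semi-arc is a portion of the diagram running from one passage through a classical crossing to the next (passing freely through virtual crossings). Each classical crossing has two smoothings ($A$ and $B$), the two ways of reconnecting the four half-edges without crossing; a state (smoothing) is a choice of smoothing at every classical crossing, and its cycles are the resulting closed curves (virtual crossings are ignored). Canonical source-sink orientation: draw a classical crossing (of either sign) so that both oriented strands point up, with half-edges SW, SE incoming and NW, NE outgoing; SW and NE are oriented toward the crossing, SE and NW away from it. A cut locus is placed on each semi-arc whose two ends carry disagreeing source-sink orientations. (The abstract link diagram of $D$ is the surface with boundary that is a regular neighbourhood of the diagram, with bands passing over/under each other at virtual crossings; each cut locus is represented there by a cross cut, where a half-twist is inserted.) An alternately coloured smoothing of $D$ (on the abstract link diagram with cross cuts) is a state $S$ together with a colouring by two colours, red and green, of the arcs into which the cut loci divide the cycles of $S$, such that the colour changes at every cut locus and the two strands at each smoothed crossing have different colours. *)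

theory Defs
  imports "HOL-Analysis.Analysis"
begin

section \<open>Virtual link diagrams\<close>

text \<open>
  The plane is the complex plane. Every circle is \<open>\<real>/\<int>\<close>, and an immersed circle is given as a
  1-periodic function on the reals; its direction of traversal is the orientation of the component.
  \<open>classical\<close> is the set of double points that carry a classical crossing (all other double points
  are virtual crossings), and \<open>over z\<close> is the overpassing one of the two points of the
  circles lying above the classical crossing \<open>z\<close>.
\<close>

record virtual_diagram =
  ncomp :: nat
  curve :: "nat \<Rightarrow> real \<Rightarrow> complex"
  classical :: "complex set"
  over :: "complex \<Rightarrow> nat \<times> real"

text \<open>Points of the disjoint union of the circles, with one representative per class mod 1.\<close>

definition points :: "virtual_diagram \<Rightarrow> (nat \<times> real) set" where
  "points D = {..<ncomp D} \<times> {0..<1}"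

definition pos :: "virtual_diagram \<Rightarrow> nat \<times> real \<Rightarrow> complex" where
  "pos D p = curve D (fst p) (snd p)"

definition velocity :: "virtual_diagram \<Rightarrow> nat \<times> real \<Rightarrow> complex" where
  "velocity D p = vector_derivative (curve D (fst p)) (at (snd p))"

text \<open>The determinant of two plane vectors: positive iff \<open>w\<close> points to the left of \<open>v\<close>.\<close>

definition plane_det :: "complex \<Rightarrow> complex \<Rightarrow> real" where
  "plane_det v w = Re v * Im w - Im v * Re w"

definition multiple_points :: "virtual_diagram \<Rightarrow> complex set" where
  "multiple_points D = {z. \<exists>p\<in>points D. \<exists>q\<in>points D. p \<noteq> q \<and> pos D p = z \<and> pos D q = z}"

definition immersed_circles :: "virtual_diagram \<Rightarrow> bool" where
  "immersed_circles D \<longleftrightarrow> (\<forall>i<ncomp D.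
     (\<forall>t. curve D i (t + 1) = curve D i t) \<and>
     curve D i C1_differentiable_on UNIV \<and>
     (\<forall>t. vector_derivative (curve D i) (at t) \<noteq> 0))"

definition generic :: "virtual_diagram \<Rightarrow> bool" where
  "generic D \<longleftrightarrow> finite (multiple_points D) \<and>
     (\<forall>z\<in>multiple_points D. card {p\<in>points D. pos D p = z} = 2) \<and>
     (\<forall>p\<in>points D. \<forall>q\<in>points D. p \<noteq> q \<and> pos D p = pos D q \<longrightarrow>
        plane_det (velocity D p) (velocity D q) \<noteq> 0)"

definition virtual_link_diagram :: "virtual_diagram \<Rightarrow> bool" where
  "virtual_link_diagram D \<longleftrightarrow> immersed_circles D \<and> generic D \<and>
     classical D \<subseteq> multiple_points D \<and>
     (\<forall>z\<in>classical D. over D z \<in> points D \<and> pos D (over D z) = z)"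


section \<open>Half-edges, semi-arcs and cut loci\<close>

definition passages :: "virtual_diagram \<Rightarrow> (nat \<times> real) set" where
  "passages D = {p\<in>points D. pos D p \<in> classical D}"

text \<open>
  The corners of a classical crossing, rotated such that both strands point up.
  In that picture the strand running from SW to NE is the one whose
  companion points to its left.
\<close>

datatype corner = SW | SE | NW | NE

definition rising_right :: "virtual_diagram \<Rightarrow> nat \<times> real \<Rightarrow> bool" where
  "rising_right D p \<longleftrightarrow> (\<exists>q\<in>points D. q \<noteq> p \<and> pos D q = pos D p \<and>
     plane_det (velocity D p) (velocity D q) > 0)"

text \<open>
  A half-edge is a classical crossing with a corner. \<open>Circle i\<close> is the whole
  \<open>i\<close>-th component when it has no classical crossing; it has no ends, hence no cut locus,
  and is a cycle of every state.
\<close>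

datatype piece = HalfEdge complex corner | Circle nat

definition half_edge_in :: "virtual_diagram \<Rightarrow> nat \<times> real \<Rightarrow> piece" where
  "half_edge_in D p = HalfEdge (pos D p) (if rising_right D p then SW else SE)"

definition half_edge_out :: "virtual_diagram \<Rightarrow> nat \<times> real \<Rightarrow> piece" where
  "half_edge_out D p = HalfEdge (pos D p) (if rising_right D p then NE else NW)"

definition pieces :: "virtual_diagram \<Rightarrow> piece set" where
  "pieces D = {HalfEdge z k | z k. z \<in> classical D} \<union>
     {Circle i | i. i < ncomp D \<and> (\<forall>t. (i, t) \<notin> passages D)}"

text \<open>
  \<open>semi_arc D p q\<close>: going along the component from the passage \<open>p\<close>, the next passage
  is \<open>q\<close>. The case \<open>p = q\<close> (after a full turn) is that of a component with a single passage.
\<close>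

definition semi_arc :: "virtual_diagram \<Rightarrow> nat \<times> real \<Rightarrow> nat \<times> real \<Rightarrow> bool" where
  "semi_arc D p q \<longleftrightarrow> p \<in> passages D \<and> q \<in> passages D \<and> fst p = fst q \<and>
     (\<exists>s>snd p. frac s = snd q \<and> (\<forall>r. snd p < r \<and> r < s \<longrightarrow> curve D (fst p) r \<notin> classical D))"

text \<open>Canonical source-sink orientation: whether a half-edge is oriented toward its crossing.\<close>

fun toward_crossing :: "piece \<Rightarrow> bool" where
  "toward_crossing (HalfEdge z k) \<longleftrightarrow> k = SW \<or> k = NE"
| "toward_crossing (Circle i) \<longleftrightarrow> False"

text \<open>
  The orientation at the initial end of the semi-arc runs along it iff it points away from the
  crossing there; at the final end iff it points toward the crossing.
\<close>

definition cut_locus :: "virtual_diagram \<Rightarrow> nat \<times> real \<Rightarrow> nat \<times> real \<Rightarrow> bool" where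
  "cut_locus D p q \<longleftrightarrow> semi_arc D p q \<and>
     (\<not> toward_crossing (half_edge_out D p)) \<noteq> toward_crossing (half_edge_in D q)"


section \<open>States\<close>

datatype smoothing = A_smoothing | B_smoothing

definition states :: "virtual_diagram \<Rightarrow> (complex \<Rightarrow> smoothing) set" where
  "states D = classical D \<rightarrow>\<^sub>E UNIV"

text \<open>
  The two strands of a smoothing, each given by the corners it connects. The A-smoothing merges
  the two regions swept out when the overpassing strand is turned counterclockwise: north and south
  if that strand runs from SW to NE, west and east if it runs from SE to NW.
\<close>

definition strands :: "virtual_diagram \<Rightarrow> complex \<Rightarrow> smoothing \<Rightarrow> corner set set" where
  "strands D z s =
     (if rising_right D (over D z) \<longleftrightarrow> s = A_smoothing
      then {{SW, NW}, {SE, NE}} else {{SW, SE}, {NW, NE}})"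

definition joined_at_crossing :: "virtual_diagram \<Rightarrow> (complex \<Rightarrow> smoothing) \<Rightarrow> (piece \<times> piece) set" where
  "joined_at_crossing D S = {(HalfEdge z k, HalfEdge z l) | z k l.
     z \<in> classical D \<and> (\<exists>T\<in>strands D z (S z). k \<in> T \<and> l \<in> T)}"

definition joined_by_semi_arc :: "virtual_diagram \<Rightarrow> (piece \<times> piece) set" where
  "joined_by_semi_arc D = {(half_edge_out D p, half_edge_in D q) | p q. semi_arc D p q}"

definition joined_by_uncut_semi_arc :: "virtual_diagram \<Rightarrow> (piece \<times> piece) set" where
  "joined_by_uncut_semi_arc D =
     {(half_edge_out D p, half_edge_in D q) | p q. semi_arc D p q \<and> \<not> cut_locus D p q}"

definition generated_equiv :: "('a \<times> 'a) set \<Rightarrow> ('a \<times> 'a) set" where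
  "generated_equiv r = (r \<union> r\<inverse>)\<^sup>*"

text \<open>
  Cycles and arcs are represented by the sets of pieces they consist of, where a half-edge stands
  for the part of its semi-arc from the crossing to the cut locus, or for the whole
  semi-arc if there is no cut locus.
\<close>

definition cycles :: "virtual_diagram \<Rightarrow> (complex \<Rightarrow> smoothing) \<Rightarrow> piece set set" where
  "cycles D S = pieces D // generated_equiv (joined_at_crossing D S \<union> joined_by_semi_arc D)"

definition arcs :: "virtual_diagram \<Rightarrow> (complex \<Rightarrow> smoothing) \<Rightarrow> piece set set" where
  "arcs D S = (\<Union>C\<in>cycles D S.
     C // generated_equiv (joined_at_crossing D S \<union> joined_by_uncut_semi_arc D))"


section \<open>Alternately coloured smoothings and orientations\<close>

datatype colour = Red | Green

definition changes_at_cut_loci ::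
    "virtual_diagram \<Rightarrow> (complex \<Rightarrow> smoothing) \<Rightarrow> (piece set \<Rightarrow> colour) \<Rightarrow> bool" where
  "changes_at_cut_loci D S f \<longleftrightarrow>
     (\<forall>p q. cut_locus D p q \<longrightarrow> (\<forall>a\<in>arcs D S. \<forall>b\<in>arcs D S.
        half_edge_out D p \<in> a \<and> half_edge_in D q \<in> b \<longrightarrow> f a \<noteq> f b))"

definition differs_at_crossings ::
    "virtual_diagram \<Rightarrow> (complex \<Rightarrow> smoothing) \<Rightarrow> (piece set \<Rightarrow> colour) \<Rightarrow> bool" where
  "differs_at_crossings D S f \<longleftrightarrow>
     (\<forall>z\<in>classical D. \<forall>T\<in>strands D z (S z). \<forall>U\<in>strands D z (S z). T \<noteq> U \<longrightarrow>
        (\<forall>k\<in>T. \<forall>l\<in>U. \<forall>a\<in>arcs D S. \<forall>b\<in>arcs D S.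
           HalfEdge z k \<in> a \<and> HalfEdge z l \<in> b \<longrightarrow> f a \<noteq> f b))"

definition alternately_coloured_smoothings ::
    "virtual_diagram \<Rightarrow> ((complex \<Rightarrow> smoothing) \<times> (piece set \<Rightarrow> colour)) set" where
  "alternately_coloured_smoothings D = {(S, f). S \<in> states D \<and> f \<in> arcs D S \<rightarrow>\<^sub>E UNIV \<and>
     changes_at_cut_loci D S f \<and> differs_at_crossings D S f}"

text \<open>
  An orientation of a component is given relative to its direction of traversal in the oriented
  diagram.
\<close>

datatype direction = Along | Against

definition orientations :: "virtual_diagram \<Rightarrow> (nat \<Rightarrow> direction) set" where
  "orientations D = {..<ncomp D} \<rightarrow>\<^sub>E UNIV"

end

theory Submission
  imports Defs
begin

text \<open>
  Whichever smoothing is chosen, the strands of an alternately coloured crossing separate SW from NE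
  and SE from NW, so the colour changes whenever one passes straight through a crossing.
  On the other hand, a semi-arc has a cut locus iff its two ends lie on strands of the same kind
  (rising to the right or rising to the left). Hence the colour of the incoming half-edge, switched
  at the strands rising to the right, is constant along each component, which leaves one binary
  choice per component. Conversely, every such choice colours the four corners of a
  crossing so that exactly one of its two smoothings joins corners of equal colours.
\<close>

section \<open>Colours and generated equivalence relations\<close>

lemma UNIV_direction: "UNIV = {Along, Against}"
  using direction.exhaust by auto

lemma colour_eq_iff: "x = y \<longleftrightarrow> (x = Green) = (y = Green)" for x y :: colour
  by (cases x; cases y) auto

lemma equiv_generated_equiv: "equiv UNIV (generated_equiv r)"
  unfolding generated_equiv_def
  by (intro equivI) (auto simp: refl_on_def intro: sym_rtrancl sym_Un_converse trans_rtrancl)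

lemma subset_generated_equiv: "r \<subseteq> generated_equiv r"
  unfolding generated_equiv_def by auto

lemma generated_equiv_invariant:
  assumes "(x, y) \<in> generated_equiv r" and "\<And>a b. (a, b) \<in> r \<Longrightarrow> h a = h b"
  shows "h x = h y"
  using assms(1) unfolding generated_equiv_def
  by (induction rule: rtrancl_induct) (auto dest: assms(2))

text \<open>Membership in \<open>A\<close> is itself an invariant: both ends of every generator lie
  in \<open>A\<close>, so the predicate takes the same value at them.\<close>

lemma generated_equiv_closed:
  assumes "(x, y) \<in> generated_equiv r" and "r \<subseteq> A \<times> A" and "x \<in> A"
  shows "y \<in> A"
  using generated_equiv_invariant[OF assms(1), of "\<lambda>v. v \<in> A"] assms(2,3) by blast

lemma plane_det_swap: "plane_det w v = - plane_det v w"
  by (simp add: plane_det_def)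

section \<open>Colourings of pieces and the smoothing attached to an orientation\<close>

definition passage_on :: "virtual_diagram \<Rightarrow> complex \<Rightarrow> bool \<Rightarrow> nat \<times> real" where
  "passage_on D z b = (THE p. p \<in> points D \<and> pos D p = z \<and> rising_right D p = b)"

definition arc_rel :: "virtual_diagram \<Rightarrow> (complex \<Rightarrow> smoothing) \<Rightarrow> (piece \<times> piece) set" where
  "arc_rel D S = generated_equiv (joined_at_crossing D S \<union> joined_by_uncut_semi_arc D)"

definition arc_of :: "virtual_diagram \<Rightarrow> (complex \<Rightarrow> smoothing) \<Rightarrow> piece \<Rightarrow> piece set" where
  "arc_of D S x = arc_rel D S `` {x}"

text \<open>Descends a colouring of pieces to the quotient by evaluating it at a chosen
  representative, which is meaningful for those \<open>h\<close> that are constant on every arc. The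
  restriction to \<open>arcs D S\<close> gives the extensional function that
  \<open>alternately_coloured_smoothings\<close> asks for.\<close>

definition arc_colouring ::
    "virtual_diagram \<Rightarrow> (complex \<Rightarrow> smoothing) \<Rightarrow> (piece \<Rightarrow> colour) \<Rightarrow> piece set \<Rightarrow> colour" where
  "arc_colouring D S h = (\<lambda>a\<in>arcs D S. h (SOME x. x \<in> a))"

text \<open>The equivalences do two jobs at once: in one direction colours agree where pieces are
  joined, so \<open>h\<close> is constant on arcs; in the other they differ across a cut locus and
  between the two strands of a smoothed crossing.\<close>

definition alternating :: "virtual_diagram \<Rightarrow> (complex \<Rightarrow> smoothing) \<Rightarrow> (piece \<Rightarrow> colour) \<Rightarrow> bool" where
  "alternating D S h \<longleftrightarrow>
     (\<forall>p q. semi_arc D p q \<longrightarrow> (h (half_edge_out D p) = h (half_edge_in D q) \<longleftrightarrow> \<not> cut_locus D p q)) \<and>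
     (\<forall>z\<in>classical D. \<forall>T\<in>strands D z (S z). \<forall>U\<in>strands D z (S z). \<forall>k\<in>T. \<forall>l\<in>U.
        h (HalfEdge z k) = h (HalfEdge z l) \<longleftrightarrow> T = U)"

text \<open>A half-edge is red iff the orientation chosen by \<open>d\<close> agrees there with the
  canonical source-sink orientation: for \<open>Along\<close>, SW and NW agree while SE and NE
  disagree, and reversing the strand swaps its colours. The argument
  \<open>k = SW \<or> k = NE\<close> selects the strand through the corner. On a
  \<open>Circle\<close> the pairing of green with \<open>Along\<close> is a convention.\<close>

fun oriented_colour :: "virtual_diagram \<Rightarrow> (nat \<Rightarrow> direction) \<Rightarrow> piece \<Rightarrow> colour" where
  "oriented_colour D d (HalfEdge z k) =
     (if (d (fst (passage_on D z (k = SW \<or> k = NE))) = Along) = (k = SE \<or> k = NE) then Green else Red)"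
| "oriented_colour D d (Circle i) = (if d i = Along then Green else Red)"

text \<open>The smoothing compatible with the orientation \<open>d\<close>: equal directions call
  for {SW, NW}, {SE, NE}, opposite ones for {SW, SE}, {NW, NE}. Comparing with
  \<open>rising_right D (over D z)\<close> turns this into the label A or B.\<close>

definition oriented_state :: "virtual_diagram \<Rightarrow> (nat \<Rightarrow> direction) \<Rightarrow> complex \<Rightarrow> smoothing" where
  "oriented_state D d = (\<lambda>z\<in>classical D.
     if (d (fst (passage_on D z True)) = d (fst (passage_on D z False))) = rising_right D (over D z)
     then A_smoothing else B_smoothing)"

definition oriented_smoothing ::
    "virtual_diagram \<Rightarrow> (nat \<Rightarrow> direction) \<Rightarrow> (complex \<Rightarrow> smoothing) \<times> (piece set \<Rightarrow> colour)" where
  "oriented_smoothing D d =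
     (oriented_state D d, arc_colouring D (oriented_state D d) (oriented_colour D d))"

lemma card_orientations: "card (orientations D) = 2 ^ ncomp D"
  by (simp add: orientations_def card_PiE UNIV_direction numeral_2_eq_2)

text \<open>The corners NE and SW, used by strands rising to the right, are the ones oriented toward
  the crossing, so the source-sink orientations of the two ends disagree precisely when both strands
  are of the same kind.\<close>

lemma cut_locus_iff:
  "cut_locus D p q \<longleftrightarrow> semi_arc D p q \<and> rising_right D p = rising_right D q"
  by (auto simp: cut_locus_def half_edge_in_def half_edge_out_def)

lemma semi_arc_passages:
  assumes "semi_arc D p q"
  shows "p \<in> passages D" "q \<in> passages D" "fst p = fst q"
  using assms by (auto simp: semi_arc_def)

lemma half_edge_pieces:
  assumes "p \<in> passages D"
  shows "half_edge_in D p \<in> pieces D" "half_edge_out D p \<in> pieces D"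
  using assms by (auto simp: passages_def pieces_def half_edge_in_def half_edge_out_def)

lemma joined_subset_pieces:
  "joined_at_crossing D S \<subseteq> pieces D \<times> pieces D"
  "joined_by_semi_arc D \<subseteq> pieces D \<times> pieces D"
  by (auto simp: joined_at_crossing_def joined_by_semi_arc_def pieces_def
      half_edge_in_def half_edge_out_def semi_arc_def passages_def)

section \<open>Arcs as equivalence classes of pieces\<close>

lemma equiv_arc_rel: "equiv UNIV (arc_rel D S)"
  unfolding arc_rel_def by (rule equiv_generated_equiv)

text \<open>The same relation is used inside every cycle, so only the union of the cycles matters;
  it is all of \<open>pieces D\<close> because joins never leave that set.\<close>

lemma arcs_eq_quotient: "arcs D S = pieces D // arc_rel D S"
proof -
  let ?r = "joined_at_crossing D S \<union> joined_by_semi_arc D"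
  have "\<Union> (cycles D S) = pieces D"
  proof
    show "\<Union> (cycles D S) \<subseteq> pieces D"
      unfolding cycles_def
      using joined_subset_pieces[of D]
      by (auto elim!: quotientE dest!: generated_equiv_closed[where A = "pieces D"])
    show "pieces D \<subseteq> \<Union> (cycles D S)"
      unfolding cycles_def
      using equiv_class_self[OF equiv_generated_equiv[of ?r]] by (auto intro!: quotientI)
  qed
  then show ?thesis
    unfolding arcs_def arc_rel_def[symmetric] quotient_def by blast
qed

lemma arc_of_in_arcs: "x \<in> pieces D \<Longrightarrow> arc_of D S x \<in> arcs D S"
  unfolding arc_of_def arcs_eq_quotient by (rule quotientI)

lemma mem_arc_of: "x \<in> arc_of D S x"
  unfolding arc_of_def using equiv_class_self[OF equiv_arc_rel] by simp

lemma arc_eq_arc_of: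
  assumes "a \<in> arcs D S" and "x \<in> a"
  shows "a = arc_of D S x"
proof -
  obtain y where a: "a = arc_rel D S `` {y}"
    using assms(1) unfolding arcs_eq_quotient by (rule quotientE)
  then have "(y, x) \<in> arc_rel D S"
    using assms(2) by simp
  then show ?thesis
    unfolding a arc_of_def by (rule equiv_class_eq[OF equiv_arc_rel])
qed

lemma arcsE:
  assumes "a \<in> arcs D S"
  obtains x where "x \<in> pieces D" "a = arc_of D S x"
  using assms unfolding arcs_eq_quotient arc_of_def by (auto elim!: quotientE)

lemma arc_of_eqI:
  assumes "(x, y) \<in> joined_at_crossing D S \<union> joined_by_uncut_semi_arc D"
  shows "arc_of D S x = arc_of D S y"
proof -
  have "(x, y) \<in> arc_rel D S"
    using assms subset_generated_equiv unfolding arc_rel_def by blast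
  then show ?thesis
    unfolding arc_of_def by (rule equiv_class_eq[OF equiv_arc_rel])
qed

section \<open>Translation between colourings of arcs and of pieces\<close>

lemma arc_colouring_arc_of:
  assumes "alternating D S h" and "x \<in> pieces D"
  shows "arc_colouring D S h (arc_of D S x) = h x"
proof -
  define y where "y = (SOME y. y \<in> arc_of D S x)"
  have "y \<in> arc_of D S x"
    unfolding y_def using mem_arc_of by (rule someI)
  then have "(x, y) \<in> generated_equiv (joined_at_crossing D S \<union> joined_by_uncut_semi_arc D)"
    by (simp add: arc_of_def arc_rel_def)
  \<comment> \<open>The ends of a generator lie on a common strand or on an uncut semi-arc, where
    \<open>alternating\<close> forces equal colours.\<close>
  then have "h x = h y"
  proof (rule generated_equiv_invariant)
    fix u v assume "(u, v) \<in> joined_at_crossing D S \<union> joined_by_uncut_semi_arc D"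
    then show "h u = h v"
      using assms(1)
      unfolding alternating_def joined_at_crossing_def joined_by_uncut_semi_arc_def by blast
  qed
  then show ?thesis
    using arc_of_in_arcs[OF assms(2)] by (simp add: arc_colouring_def y_def)
qed

text \<open>Exactly one arc passes through a given piece, so the quantifiers over arcs collapse to
  \<open>arc_of\<close>.\<close>

lemma changes_at_cut_loci_iff:
  "changes_at_cut_loci D S f \<longleftrightarrow>
     (\<forall>p q. cut_locus D p q \<longrightarrow> f (arc_of D S (half_edge_out D p)) \<noteq> f (arc_of D S (half_edge_in D q)))"
  (is "_ \<longleftrightarrow> ?R")
proof
  assume L: "changes_at_cut_loci D S f"
  show ?R
  proof (intro allI impI)
    fix p q assume c: "cut_locus D p q"
    then have "semi_arc D p q"
      by (simp add: cut_locus_def)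
    note p = semi_arc_passages[OF this]
    show "f (arc_of D S (half_edge_out D p)) \<noteq> f (arc_of D S (half_edge_in D q))"
      using L[unfolded changes_at_cut_loci_def, rule_format, OF c
          arc_of_in_arcs[OF half_edge_pieces(2)[OF p(1)]] arc_of_in_arcs[OF half_edge_pieces(1)[OF p(2)]]]
        mem_arc_of by blast
  qed
next
  assume ?R
  then show "changes_at_cut_loci D S f"
    unfolding changes_at_cut_loci_def using arc_eq_arc_of by metis
qed

lemma differs_at_crossings_iff:
  "differs_at_crossings D S f \<longleftrightarrow>
     (\<forall>z\<in>classical D. \<forall>T\<in>strands D z (S z). \<forall>U\<in>strands D z (S z). T \<noteq> U \<longrightarrow>
        (\<forall>k\<in>T. \<forall>l\<in>U. f (arc_of D S (HalfEdge z k)) \<noteq> f (arc_of D S (HalfEdge z l))))"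
  (is "_ \<longleftrightarrow> ?R")
proof
  assume L: "differs_at_crossings D S f"
  have "arc_of D S (HalfEdge z k) \<in> arcs D S" if "z \<in> classical D" for z k
    using that by (intro arc_of_in_arcs) (auto simp: pieces_def)
  then show ?R
    using L mem_arc_of unfolding differs_at_crossings_def by meson
next
  assume R: ?R
  show "differs_at_crossings D S f"
    unfolding differs_at_crossings_def
  proof (intro ballI impI)
    fix z T U k l a b
    assume *: "z \<in> classical D" "T \<in> strands D z (S z)" "U \<in> strands D z (S z)" "T \<noteq> U"
      "k \<in> T" "l \<in> U" and a: "a \<in> arcs D S" and b: "b \<in> arcs D S"
      and ab: "HalfEdge z k \<in> a \<and> HalfEdge z l \<in> b"
    have "a = arc_of D S (HalfEdge z k)" "b = arc_of D S (HalfEdge z l)"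
      using arc_eq_arc_of a b ab by blast+
    then show "f a \<noteq> f b"
      using R * by blast
  qed
qed

text \<open>Joined pieces lie on one arc and so share its colour; the remaining cases are the two
  conditions on an alternately coloured smoothing.\<close>

lemma alternating_of_arcs:
  assumes "(S, f) \<in> alternately_coloured_smoothings D"
  shows "alternating D S (\<lambda>x. f (arc_of D S x))"
  unfolding alternating_def
proof (intro conjI allI ballI impI)
  fix p q assume sa: "semi_arc D p q"
  show "f (arc_of D S (half_edge_out D p)) = f (arc_of D S (half_edge_in D q)) \<longleftrightarrow> \<not> cut_locus D p q"
  proof (cases "cut_locus D p q")
    case True
    then show ?thesis
      using assms unfolding alternately_coloured_smoothings_def changes_at_cut_loci_iff by blast
  next
    case False
    then have "(half_edge_out D p, half_edge_in D q) \<in> joined_by_uncut_semi_arc D"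
      using sa unfolding joined_by_uncut_semi_arc_def by blast
    then show ?thesis
      using False arc_of_eqI by (metis UnI2)
  qed
next
  fix z T U k l
  assume z: "z \<in> classical D" and T: "T \<in> strands D z (S z)" and U: "U \<in> strands D z (S z)"
    and k: "k \<in> T" and l: "l \<in> U"
  show "f (arc_of D S (HalfEdge z k)) = f (arc_of D S (HalfEdge z l)) \<longleftrightarrow> T = U"
  proof (cases "T = U")
    case True
    then have "(HalfEdge z k, HalfEdge z l) \<in> joined_at_crossing D S"
      using z T k l by (auto simp: joined_at_crossing_def)
    then show ?thesis
      using True arc_of_eqI by (metis UnI1)
  next
    case False
    then show ?thesis
      using assms z T U k l
      by (auto simp: alternately_coloured_smoothings_def differs_at_crossings_iff)
  qed
qed

lemma arc_colouring_alternately_coloured: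
  assumes "alternating D S h" and "S \<in> states D"
  shows "(S, arc_colouring D S h) \<in> alternately_coloured_smoothings D"
proof -
  have "changes_at_cut_loci D S (arc_colouring D S h)"
    unfolding changes_at_cut_loci_iff
  proof (intro allI impI)
    fix p q assume c: "cut_locus D p q"
    then have sa: "semi_arc D p q"
      by (simp add: cut_locus_def)
    have "h (half_edge_out D p) \<noteq> h (half_edge_in D q)"
      using assms(1) c sa unfolding alternating_def by blast
    then show "arc_colouring D S h (arc_of D S (half_edge_out D p))
        \<noteq> arc_colouring D S h (arc_of D S (half_edge_in D q))"
      using semi_arc_passages[OF sa] by (simp add: arc_colouring_arc_of[OF assms(1)] half_edge_pieces)
  qed
  moreover have "HalfEdge z k \<in> pieces D" if "z \<in> classical D" for z k
    using that by (auto simp: pieces_def)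
  then have "differs_at_crossings D S (arc_colouring D S h)"
    unfolding differs_at_crossings_iff using assms(1)
    by (simp add: arc_colouring_arc_of[OF assms(1)] alternating_def)
  ultimately show ?thesis
    using assms(2) by (auto simp: alternately_coloured_smoothings_def arc_colouring_def)
qed

section \<open>The two passages through a classical crossing\<close>

locale link_diagram =
  fixes D :: virtual_diagram
  assumes diagram: "virtual_link_diagram D"
begin

text \<open>Genericity puts exactly two points above the crossing, with transverse velocities. The
  determinant is nonzero and antisymmetric, so one of them rises to the right and the other does
  not. This makes the \<open>THE\<close> in \<open>passage_on\<close> well defined.\<close>

lemma ex1_passage_on:
  assumes "z \<in> classical D"
  shows "\<exists>!p. p \<in> points D \<and> pos D p = z \<and> rising_right D p = b"
proof -
  have "card {p \<in> points D. pos D p = z} = 2"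
    using diagram assms by (auto simp: virtual_link_diagram_def generic_def)
  then obtain p q where pq: "{p \<in> points D. pos D p = z} = {p, q}" "p \<noteq> q"
    by (auto simp: card_2_iff)
  have mem: "x \<in> points D \<and> pos D x = z \<longleftrightarrow> x = p \<or> x = q" for x
    using pq(1) by blast
  have "plane_det (velocity D p) (velocity D q) \<noteq> 0"
    using diagram mem pq(2) unfolding virtual_link_diagram_def generic_def by metis
  \<comment> \<open>The companion in \<open>rising_right\<close> can only be the other one of the
    two points.\<close>
  moreover have "rising_right D p \<longleftrightarrow> plane_det (velocity D p) (velocity D q) > 0"
    unfolding rising_right_def using mem pq(2) by metis
  moreover have "rising_right D q \<longleftrightarrow> plane_det (velocity D q) (velocity D p) > 0"
    unfolding rising_right_def using mem pq(2) by metis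
  ultimately have "rising_right D p \<noteq> rising_right D q"
    using plane_det_swap[of "velocity D q" "velocity D p"] by auto
  then show ?thesis
    using mem by metis
qed

lemma passage_on:
  assumes "z \<in> classical D"
  shows "passage_on D z b \<in> passages D" "pos D (passage_on D z b) = z"
    "rising_right D (passage_on D z b) = b"
  using theI'[OF ex1_passage_on[OF assms, of b]] assms
  by (auto simp: passage_on_def passages_def)

lemma passage_on_pos:
  assumes "p \<in> passages D" and "rising_right D p = b"
  shows "passage_on D (pos D p) b = p"
  unfolding passage_on_def using assms
  by (intro the1_equality ex1_passage_on) (auto simp: passages_def)

lemma half_edge_cases:
  assumes "z \<in> classical D"
  obtains p where "p \<in> passages D"
    "HalfEdge z k = half_edge_in D p \<or> HalfEdge z k = half_edge_out D p"
  using passage_on[OF assms, of "k = SW \<or> k = NE"]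
  by (intro that[of "passage_on D z (k = SW \<or> k = NE)"])
    (cases k; simp add: half_edge_in_def half_edge_out_def)+

section \<open>From orientations to alternately coloured smoothings\<close>

lemma oriented_colour_half_edge_in:
  assumes "p \<in> passages D"
  shows "oriented_colour D d (half_edge_in D p) = Green \<longleftrightarrow> (d (fst p) = Along) \<noteq> rising_right D p"
  using passage_on_pos[OF assms] by (auto simp: half_edge_in_def)

lemma oriented_colour_half_edge_out:
  assumes "p \<in> passages D"
  shows "oriented_colour D d (half_edge_out D p) = Green \<longleftrightarrow> (d (fst p) = Along) = rising_right D p"
  using passage_on_pos[OF assms] by (auto simp: half_edge_out_def)

text \<open>The ends of a semi-arc lie on one component and share its direction, so their colours
  differ precisely when both strands are of the same kind, which is the condition for a cut locus.
  At a crossing the four combinations of directions are checked.\<close>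

lemma alternating_oriented: "alternating D (oriented_state D d) (oriented_colour D d)"
  unfolding alternating_def
proof (intro conjI allI ballI impI)
  fix p q assume sa: "semi_arc D p q"
  note p = semi_arc_passages[OF sa]
  show "oriented_colour D d (half_edge_out D p) = oriented_colour D d (half_edge_in D q)
      \<longleftrightarrow> \<not> cut_locus D p q"
    using p sa colour_eq_iff[of "oriented_colour D d (half_edge_out D p)"]
    by (auto simp: oriented_colour_half_edge_in oriented_colour_half_edge_out cut_locus_iff)
next
  fix z T U k l
  assume z: "z \<in> classical D" and mem: "T \<in> strands D z (oriented_state D d z)"
    "U \<in> strands D z (oriented_state D d z)" "k \<in> T" "l \<in> U"
  \<comment> \<open>\<open>rising_right D (over D z)\<close> enters both \<open>strands\<close> and
    \<open>oriented_state\<close> and cancels; only the comparison of the two directions is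
    left.\<close>
  have strands: "strands D z (oriented_state D d z) =
      (if d (fst (passage_on D z True)) = d (fst (passage_on D z False))
       then {{SW, NW}, {SE, NE}} else {{SW, SE}, {NW, NE}})"
    using z by (simp add: strands_def oriented_state_def)
  have "\<forall>T\<in>strands D z (oriented_state D d z). \<forall>U\<in>strands D z (oriented_state D d z).
      \<forall>k\<in>T. \<forall>l\<in>U. oriented_colour D d (HalfEdge z k) = oriented_colour D d (HalfEdge z l) \<longleftrightarrow> T = U"
    unfolding strands
    by (cases "d (fst (passage_on D z True))"; cases "d (fst (passage_on D z False))")
      (simp_all add: doubleton_eq_iff)
  then show "oriented_colour D d (HalfEdge z k) = oriented_colour D d (HalfEdge z l) \<longleftrightarrow> T = U"
    using mem by blast
qed

lemma oriented_state_in_states: "oriented_state D d \<in> states D"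
  by (auto simp: oriented_state_def states_def)

lemma oriented_smoothing_in:
  "oriented_smoothing D d \<in> alternately_coloured_smoothings D"
  unfolding oriented_smoothing_def
  by (intro arc_colouring_alternately_coloured alternating_oriented oriented_state_in_states)

text \<open>A direction can be read off a single piece of its component: the incoming half-edge of
  any passage, or the whole circle if there is no passage.\<close>

lemma oriented_smoothing_inj:
  "inj_on (oriented_smoothing D) (orientations D)"
proof (rule inj_onI)
  fix d e assume d: "d \<in> orientations D" and e: "e \<in> orientations D"
    and eq: "oriented_smoothing D d = oriented_smoothing D e"
  have col: "oriented_colour D d x = oriented_colour D e x" if "x \<in> pieces D" for x
    using eq arc_colouring_arc_of[OF alternating_oriented that, of d]
      arc_colouring_arc_of[OF alternating_oriented that, of e]
    by (metis oriented_smoothing_def prod.inject)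
  have "d i = e i" if i: "i < ncomp D" for i
  proof (cases "\<exists>t. (i, t) \<in> passages D")
    case True
    then obtain t where t: "(i, t) \<in> passages D" by blast
    have "(d i = Along) = (e i = Along)"
      using oriented_colour_half_edge_in[OF t, of d] oriented_colour_half_edge_in[OF t, of e]
      unfolding col[OF half_edge_pieces(1)[OF t]] fst_conv by argo
    then show ?thesis using direction.exhaust by metis
  next
    case False
    then have "Circle i \<in> pieces D"
      using i by (auto simp: pieces_def)
    from col[OF this] have "(d i = Along) = (e i = Along)" by (auto split: if_splits)
    then show ?thesis using direction.exhaust by metis
  qed
  then show "d = e"
    using d e unfolding orientations_def by (intro PiE_ext) auto
qed

section \<open>Colours along a component\<close>

lemma finite_passages: "finite (passages D)"
proof (rule finite_subset)
  show "passages D \<subseteq> (\<Union>z\<in>multiple_points D. {p \<in> points D. pos D p = z})"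
    using diagram by (auto simp: passages_def virtual_link_diagram_def)
  have "finite {p \<in> points D. pos D p = z}" if "z \<in> multiple_points D" for z
    using diagram that by (intro card_ge_0_finite) (auto simp: virtual_link_diagram_def generic_def)
  then show "finite (\<Union>z\<in>multiple_points D. {p \<in> points D. pos D p = z})"
    using diagram by (auto simp: virtual_link_diagram_def generic_def)
qed

text \<open>Induction on the number of passages strictly between the two parameters: with none, the
  two passages bound a semi-arc; otherwise any intermediate one splits the interval into two with
  fewer.\<close>

lemma component_connected:
  assumes "\<And>p q. semi_arc D p q \<Longrightarrow> g p = g q"
  shows "(i, s) \<in> passages D \<Longrightarrow> (i, t) \<in> passages D \<Longrightarrow> s < t \<Longrightarrow> g (i, s) = g (i, t)"
proof (induction "card {r. (i, r) \<in> passages D \<and> s < r \<and> r < t}" arbitrary: s t rule: less_induct)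
  case less
  have fin: "finite {r. (i, r) \<in> passages D \<and> P r}" for P
    by (rule finite_surj[OF finite_passages, where f = snd]) force
  have bounds: "i < ncomp D" "0 \<le> s" "t < 1"
    using less.prems by (auto simp: passages_def points_def)
  show ?case
  proof (cases "\<exists>r. (i, r) \<in> passages D \<and> s < r \<and> r < t")
    case True
    then obtain r where r: "(i, r) \<in> passages D" "s < r" "r < t" by blast
    have "{u. (i, u) \<in> passages D \<and> s < u \<and> u < r} \<subset> {u. (i, u) \<in> passages D \<and> s < u \<and> u < t}"
      "{u. (i, u) \<in> passages D \<and> r < u \<and> u < t} \<subset> {u. (i, u) \<in> passages D \<and> s < u \<and> u < t}"
      using r by auto
    note smaller = this[THEN psubset_card_mono[OF fin]]
    have "g (i, s) = g (i, r)"
      by (rule less.hyps[OF smaller(1) less.prems(1) r(1,2)])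
    also have "\<dots> = g (i, t)"
      by (rule less.hyps[OF smaller(2) r(1) less.prems(2) r(3)])
    finally show ?thesis .
  next
    case False
    then have "curve D i r \<notin> classical D" if "s < r" "r < t" for r
      using that bounds by (auto simp: passages_def points_def pos_def)
    \<comment> \<open>As \<open>t\<close> lies in [0, 1), it can itself serve as the end parameter
      in \<open>semi_arc\<close>.\<close>
    moreover have "frac t = t"
      using less.prems bounds by (simp add: frac_eq)
    ultimately have "semi_arc D (i, s) (i, t)"
      using less.prems unfolding semi_arc_def by auto
    then show ?thesis by (rule assms)
  qed
qed

text \<open>SW and NE lie on different strands in both smoothings, as do SE and NW. SW and NW share
  a strand in just one smoothing, so the third conclusion lets the colours determine the
  state.\<close>

lemma alternating_opposite:
  assumes "alternating D S h" and "z \<in> classical D"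
  shows "h (HalfEdge z NE) \<noteq> h (HalfEdge z SW)" "h (HalfEdge z NW) \<noteq> h (HalfEdge z SE)"
    and "h (HalfEdge z SW) = h (HalfEdge z NW) \<longleftrightarrow> rising_right D (over D z) = (S z = A_smoothing)"
proof -
  have *: "\<forall>T\<in>strands D z (S z). \<forall>U\<in>strands D z (S z). \<forall>k\<in>T. \<forall>l\<in>U.
      h (HalfEdge z k) = h (HalfEdge z l) \<longleftrightarrow> T = U"
    using assms unfolding alternating_def by blast
  have "h (HalfEdge z NE) \<noteq> h (HalfEdge z SW) \<and> h (HalfEdge z NW) \<noteq> h (HalfEdge z SE) \<and>
    (h (HalfEdge z SW) = h (HalfEdge z NW) \<longleftrightarrow> rising_right D (over D z) = (S z = A_smoothing))"
    (is "?R \<and> ?L \<and> (?M \<longleftrightarrow> ?P)")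
  proof (cases ?P)
    case True
    then have "strands D z (S z) = {{SW, NW}, {SE, NE}}"
      by (simp add: strands_def)
    then have "h (HalfEdge z NE) = h (HalfEdge z SW) \<longleftrightarrow> {SE, NE} = {SW, NW}"
      "h (HalfEdge z NW) = h (HalfEdge z SE) \<longleftrightarrow> {SW, NW} = {SE, NE}"
      "h (HalfEdge z SW) = h (HalfEdge z NW) \<longleftrightarrow> {SW, NW} = {SW, NW}"
      by (intro *[rule_format]; simp)+
    then have "?R \<and> ?L \<and> ?M" by (simp add: doubleton_eq_iff)
    with True show ?thesis by blast
  next
    case False
    then have "strands D z (S z) = {{SW, SE}, {NW, NE}}"
      by (simp add: strands_def)
    then have "h (HalfEdge z NE) = h (HalfEdge z SW) \<longleftrightarrow> {NW, NE} = {SW, SE}"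
      "h (HalfEdge z NW) = h (HalfEdge z SE) \<longleftrightarrow> {NW, NE} = {SW, SE}"
      "h (HalfEdge z SW) = h (HalfEdge z NW) \<longleftrightarrow> {SW, SE} = {NW, NE}"
      by (intro *[rule_format]; simp)+
    then have "?R \<and> ?L \<and> \<not> ?M" by (simp add: doubleton_eq_iff)
    with False show ?thesis by blast
  qed
  then show "h (HalfEdge z NE) \<noteq> h (HalfEdge z SW)" "h (HalfEdge z NW) \<noteq> h (HalfEdge z SE)"
    "h (HalfEdge z SW) = h (HalfEdge z NW) \<longleftrightarrow> rising_right D (over D z) = (S z = A_smoothing)"
    by blast+
qed

lemma alternating_passage:
  assumes "alternating D S h" and "p \<in> passages D"
  shows "h (half_edge_out D p) \<noteq> h (half_edge_in D p)"
  using alternating_opposite[OF assms(1), of "pos D p"] assms(2)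
  by (auto simp: half_edge_in_def half_edge_out_def passages_def)

lemma alternating_component:
  assumes "alternating D S h" and "p \<in> passages D" and "q \<in> passages D" and "fst p = fst q"
  shows "((h (half_edge_in D p) = Green) \<noteq> rising_right D p) =
    ((h (half_edge_in D q) = Green) \<noteq> rising_right D q)"
proof -
  let ?g = "\<lambda>p. (h (half_edge_in D p) = Green) \<noteq> rising_right D p"
  \<comment> \<open>Passing through \<open>u\<close> switches the colour, and the semi-arc to
    \<open>v\<close> switches it again iff both strands are of the same kind. In total the incoming
    colour changes iff the kind does.\<close>
  have g: "?g u = ?g v" if "semi_arc D u v" for u v
  proof -
    have "h (half_edge_out D u) = h (half_edge_in D v) \<longleftrightarrow> rising_right D u \<noteq> rising_right D v"
      using assms(1) that unfolding alternating_def cut_locus_iff by blast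
    moreover have "h (half_edge_out D u) \<noteq> h (half_edge_in D u)"
      by (rule alternating_passage[OF assms(1) semi_arc_passages(1)[OF that]])
    ultimately show ?thesis
      by (metis (full_types) colour.exhaust)
  qed
  obtain i s t where p: "p = (i, s)" and q: "q = (i, t)"
    using assms(4) by (metis prod.collapse)
  have "?g (i, s) = ?g (i, t)"
  proof (cases s t rule: linorder_cases)
    case less
    show ?thesis
      by (rule component_connected[of ?g, OF g assms(2,3)[unfolded p q] less])
  next
    case equal
    then show ?thesis by simp
  next
    case greater
    show ?thesis
      by (rule component_connected[of ?g, OF g assms(3,2)[unfolded p q] greater, symmetric])
  qed
  then show ?thesis
    by (simp only: p q)
qed

section \<open>Recovering the orientation from the colouring\<close>

lemma alternating_imp_oriented:
  assumes alt: "alternating D S h" and S: "S \<in> states D"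
  obtains d where "d \<in> orientations D" "S = oriented_state D d"
    "\<And>x. x \<in> pieces D \<Longrightarrow> h x = oriented_colour D d x"
proof -
  \<comment> \<open>By \<open>alternating_component\<close> the switched incoming colour is the same
    at all passages of a component, so any witness of the existential gives the same direction. The
    last branch serves components without classical crossings.\<close>
  define along where "along i \<longleftrightarrow>
    (if \<exists>p\<in>passages D. fst p = i
     then \<exists>p\<in>passages D. fst p = i \<and> (h (half_edge_in D p) = Green) \<noteq> rising_right D p
     else h (Circle i) = Green)" for i
  define d where "d = (\<lambda>i\<in>{..<ncomp D}. if along i then Along else Against)"
  have d_along: "d i = Along \<longleftrightarrow> along i" if "i < ncomp D" for i
    using that by (simp add: d_def)
  have along: "along (fst p) \<longleftrightarrow> (h (half_edge_in D p) = Green) \<noteq> rising_right D p"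
    if "p \<in> passages D" for p
    using alternating_component[OF alt that] that unfolding along_def by metis
  have lt: "fst p < ncomp D" if "p \<in> passages D" for p
    using that by (auto simp: passages_def points_def)
  have "d \<in> orientations D"
    by (auto simp: d_def orientations_def)
  moreover have h: "h x = oriented_colour D d x" if x: "x \<in> pieces D" for x
  proof (cases x)
    case (HalfEdge z k)
    then have "z \<in> classical D" using x by (auto simp: pieces_def)
    then obtain p where p: "p \<in> passages D" "x = half_edge_in D p \<or> x = half_edge_out D p"
      using half_edge_cases HalfEdge by metis
    have "h (half_edge_in D p) = Green \<longleftrightarrow> oriented_colour D d (half_edge_in D p) = Green"
      using along[OF p(1)] d_along[OF lt[OF p(1)]] oriented_colour_half_edge_in[OF p(1)] by auto
    \<comment> \<open>Both colourings switch in passing through the crossing, so with two colours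
      their agreement carries over from the incoming to the outgoing half-edge.\<close>
    moreover have "h (half_edge_out D p) = Green \<longleftrightarrow> oriented_colour D d (half_edge_out D p) = Green"
      using calculation alternating_passage[OF alt p(1)] alternating_passage[OF alternating_oriented p(1)]
      by (metis (full_types) colour.exhaust)
    ultimately show ?thesis
      using p(2) colour_eq_iff by blast
  next
    case (Circle i)
    then have i: "i < ncomp D" "\<not> (\<exists>p\<in>passages D. fst p = i)"
      using x by (auto simp: pieces_def)
    then have "h x = Green \<longleftrightarrow> oriented_colour D d x = Green"
      using Circle d_along[OF i(1)] by (simp add: along_def)
    then show ?thesis using colour_eq_iff by blast
  qed
  moreover have "S = oriented_state D d"
  proof -
    have "S z = oriented_state D d z" if z: "z \<in> classical D" for z
    proof -
      have "HalfEdge z k \<in> pieces D" for k using z by (auto simp: pieces_def)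
      \<comment> \<open>Whether SW and NW have equal colours decides between the two smoothings, and
        the two colourings agree there.\<close>
      then have "(S z = A_smoothing) = (oriented_state D d z = A_smoothing)"
        using alternating_opposite(3)[OF alt z] alternating_opposite(3)[OF alternating_oriented z] h
        by metis
      then show ?thesis using smoothing.exhaust by metis
    qed
    then show ?thesis
      using S oriented_state_in_states[of d] unfolding states_def by (intro PiE_ext) auto
  qed
  ultimately show thesis using that by blast
qed

text \<open>Evaluating \<open>f\<close> at the arc of each piece gives an alternating colouring,
  which comes from some \<open>d\<close>. Every arc is the arc of a piece, and both colourings are
  extensional on arcs, so \<open>f\<close> itself is recovered.\<close>

lemma oriented_smoothing_surj:
  assumes "(S, f) \<in> alternately_coloured_smoothings D"
  shows "(S, f) \<in> oriented_smoothing D ` orientations D"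
proof -
  have S: "S \<in> states D" and f: "f \<in> arcs D S \<rightarrow>\<^sub>E UNIV"
    using assms by (auto simp: alternately_coloured_smoothings_def)
  obtain d where d: "d \<in> orientations D" "S = oriented_state D d"
    and h: "\<And>x. x \<in> pieces D \<Longrightarrow> f (arc_of D S x) = oriented_colour D d x"
    by (rule alternating_imp_oriented[OF alternating_of_arcs[OF assms] S]) blast
  have "f a = arc_colouring D S (oriented_colour D d) a" if "a \<in> arcs D S" for a
    using that
  proof (rule arcsE)
    fix x assume x: "x \<in> pieces D" and a: "a = arc_of D S x"
    show ?thesis
      using arc_colouring_arc_of[OF alternating_oriented x, of d] h[OF x] d(2) a by simp
  qed
  then have "f = arc_colouring D S (oriented_colour D d)"
    by (intro PiE_ext[OF f]) (auto simp: arc_colouring_def)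
  then have "(S, f) = oriented_smoothing D d"
    by (simp add: oriented_smoothing_def d(2))
  then show ?thesis using d(1) by blast
qed

lemma bij_betw_oriented_smoothing:
  "bij_betw (oriented_smoothing D) (orientations D) (alternately_coloured_smoothings D)"
  unfolding bij_betw_def
  using oriented_smoothing_inj oriented_smoothing_in oriented_smoothing_surj by auto

end

theorem theorem4p3:
  fixes D :: virtual_diagram and c :: nat
  assumes "virtual_link_diagram D" and "ncomp D = c"
  shows "card (alternately_coloured_smoothings D) = 2 ^ c \<and>
    card (orientations D) = 2 ^ c \<and>
    (\<exists>\<Phi>. bij_betw \<Phi> (alternately_coloured_smoothings D) (orientations D))"
proof -
  interpret link_diagram D
    using assms(1) by unfold_locales
  \<comment> \<open>The count of orientations transfers along the bijection, whose inverse is the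
    required correspondence.\<close>
  show ?thesis
    using bij_betw_oriented_smoothing bij_betw_same_card bij_betw_inv card_orientations assms(2)
    by metis
qed

end
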